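(* Let $x_1,\dots,x_n$ be nonzero vectors in $\mathbb{O}\oplus\mathbb{O}$. Then $$\sum_{j=1}^n\sum_{i=1}^n|x_j|^2\,|\operatorname{Proj}_{L(x_j)}x_i|^2-8\sum_{j=1}^n\sum_{i=1}^n\langle x_i,x_j\rangle^2\le 0.$$
   Context: $\mathbb{O}$ is the real 8-dimensional algebra of octonions with its standard Euclidean inner product $\langle a,b\rangle=\frac12(a^*b+b^*a)$, where $*$ is octonionic conjugation; $\mathbb{O}\oplus\mathbb{O}\cong\mathbb{R}^{16}$ carries the direct-sum inner product. The octonionic lines in $\mathbb{O}\oplus\mathbb{O}$ are the 8-dimensional real subspaces $\ell_m=\{(u,mu): u\in\mathbb{O}\}$ for $m\in\mathbb{O}$ and $\ell_\infty=\{(0,u):u\in\mathbb{O}\}$. Any two distinct octonionic lines meet only at the origin, and each nonzero $x\in\mathbb{O}\oplus\mathbb{O}$ lies on exactly one octonionic line, denoted $L(x)$. $\operatorname{Proj}_{V}$ denotes orthogonal projection onto the real subspace $V$. *)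

theory Defs
  imports "HOL-Analysis.Analysis"
begin

text \<open>
  The octonions are obtained from the complex numbers by applying the Cayley--Dickson construction
  twice, with the doubling product \<open>(a,b)(c,d) = (a c - d* b, d a + b c*)\<close> and the conjugation
  \<open>(a,b)* = (a*, -b)\<close>.  The carriers are product types, so addition, the real
  vector space structure, the Euclidean inner product and the norm are the library instances;
  lemma \<open>oct_inner_eq\<close> below identifies that inner product with \<open>(a* b + b* a)/2\<close>.
\<close>

type_synonym quat = "complex \<times> complex"
type_synonym oct = "quat \<times> quat"

definition quat_cnj :: "quat \<Rightarrow> quat" where
  "quat_cnj p = (cnj (fst p), - snd p)"

definition quat_mult :: "quat \<Rightarrow> quat \<Rightarrow> quat" where
  "quat_mult p q =
     (fst p * fst q - cnj (snd q) * snd p, snd q * fst p + snd p * cnj (fst q))"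

definition oct_cnj :: "oct \<Rightarrow> oct" where
  "oct_cnj x = (quat_cnj (fst x), - snd x)"

definition oct_mult :: "oct \<Rightarrow> oct \<Rightarrow> oct"  (infixl \<open>\<otimes>\<^sub>O\<close> 70) where
  "x \<otimes>\<^sub>O y =
     (quat_mult (fst x) (fst y) - quat_mult (quat_cnj (snd y)) (snd x),
      quat_mult (snd y) (fst x) + quat_mult (snd x) (quat_cnj (fst y)))"

definition oct_of_real :: "real \<Rightarrow> oct" where
  "oct_of_real r = ((of_real r, 0), 0)"

definition oct_line :: "oct \<Rightarrow> (oct \<times> oct) set" where
  "oct_line m = range (\<lambda>u. (u, m \<otimes>\<^sub>O u))"

definition oct_line_inf :: "(oct \<times> oct) set" where
  "oct_line_inf = range (\<lambda>u. (0, u))"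

definition oct_lines :: "(oct \<times> oct) set set" where
  "oct_lines = insert oct_line_inf (range oct_line)"

text \<open>Meaningful for nonzero \<open>x\<close> only; see \<open>oct_line_through_unique\<close>.\<close>

definition line_through :: "oct \<times> oct \<Rightarrow> (oct \<times> oct) set" where
  "line_through x = (THE L. L \<in> oct_lines \<and> x \<in> L)"

text \<open>Meaningful for subspaces \<open>V\<close> only; see \<open>orth_proj_unique\<close>.\<close>

definition orth_proj :: "'a::euclidean_space set \<Rightarrow> 'a \<Rightarrow> 'a" where
  "orth_proj V x = (THE y. y \<in> V \<and> (\<forall>v\<in>V. orthogonal (x - y) v))"


subsection \<open>Sanity of the definitions\<close>

lemmas oct_defs = oct_mult_def oct_cnj_def oct_of_real_def quat_mult_def quat_cnj_def

lemma oct_inner_eq: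
  "oct_of_real (inner a b) = (1/2) *\<^sub>R (oct_cnj a \<otimes>\<^sub>O b + oct_cnj b \<otimes>\<^sub>O a)"
  by (cases a; cases b)
     (auto simp: oct_defs inner_prod_def inner_complex_def complex_eq_iff zero_prod_def
        prod_eq_iff algebra_simps)

lemma oct_norm_mult: "norm (a \<otimes>\<^sub>O b) = norm a * norm b"
proof -
  have "(norm (a \<otimes>\<^sub>O b))\<^sup>2 = (norm a * norm b)\<^sup>2"
    by (cases a; cases b)
       (auto simp: oct_defs power_mult_distrib power2_norm_eq_inner inner_prod_def
          inner_complex_def algebra_simps)
  then show ?thesis by (simp add: power2_eq_iff_nonneg)
qed

lemma oct_mult_add_right: "m \<otimes>\<^sub>O (u + v) = m \<otimes>\<^sub>O u + m \<otimes>\<^sub>O v"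
  and oct_mult_diff_left: "(m - m') \<otimes>\<^sub>O u = m \<otimes>\<^sub>O u - m' \<otimes>\<^sub>O u"
  and oct_mult_scaleR_left: "(c *\<^sub>R m) \<otimes>\<^sub>O u = c *\<^sub>R (m \<otimes>\<^sub>O u)"
  and oct_mult_scaleR_right: "m \<otimes>\<^sub>O (c *\<^sub>R u) = c *\<^sub>R (m \<otimes>\<^sub>O u)"
  by (auto simp: oct_defs prod_eq_iff complex_eq_iff algebra_simps)

lemma oct_mult_zero_right [simp]: "m \<otimes>\<^sub>O 0 = 0"
  by (simp add: oct_defs zero_prod_def)

lemma oct_mult_eq_0_iff: "a \<otimes>\<^sub>O b = 0 \<longleftrightarrow> a = 0 \<or> b = 0"
  by (metis mult_eq_0_iff norm_eq_zero oct_norm_mult)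

lemma oct_mult_cnj_cancel: "(v \<otimes>\<^sub>O oct_cnj u) \<otimes>\<^sub>O u = (norm u)\<^sup>2 *\<^sub>R v"
  by (cases u; cases v)
     (auto simp: oct_defs power2_norm_eq_inner inner_prod_def inner_complex_def prod_eq_iff
        complex_eq_iff algebra_simps)

lemma mem_oct_line_iff: "(u, v) \<in> oct_line m \<longleftrightarrow> v = m \<otimes>\<^sub>O u"
  unfolding oct_line_def by blast

lemma mem_oct_line_inf_iff: "(u, v) \<in> oct_line_inf \<longleftrightarrow> u = 0"
  unfolding oct_line_inf_def by blast

lemma subspace_oct_lines:
  assumes "L \<in> oct_lines"
  shows "subspace L"
proof -
  have "linear (\<lambda>u. (0::oct, u::oct))"
    by (rule linearI) auto
  then have "subspace oct_line_inf"
    unfolding oct_line_inf_def by (rule linear_subspace_image) simp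
  moreover have "subspace (oct_line m)" for m
  proof -
    have "linear (\<lambda>u. (u, m \<otimes>\<^sub>O u))"
      by (rule linearI) (simp_all add: oct_mult_add_right oct_mult_scaleR_right)
    then show ?thesis
      unfolding oct_line_def by (rule linear_subspace_image) simp
  qed
  ultimately show ?thesis
    using assms by (auto simp: oct_lines_def)
qed

lemma oct_line_through_unique:
  assumes "x \<noteq> 0"
  shows "\<exists>!L. L \<in> oct_lines \<and> x \<in> L"
proof -
  obtain u v where x: "x = (u, v)" by (cases x)
  show ?thesis
  proof (cases "u = 0")
    case True
    with assms x have v: "v \<noteq> 0" by (simp add: zero_prod_def)
    show ?thesis
      unfolding x
    proof (rule ex1I[of _ oct_line_inf])
      show "oct_line_inf \<in> oct_lines \<and> (u, v) \<in> oct_line_inf"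
        by (simp add: oct_lines_def mem_oct_line_inf_iff True)
      show "L = oct_line_inf" if "L \<in> oct_lines \<and> (u, v) \<in> L" for L
        using that v by (auto simp only: oct_lines_def mem_oct_line_iff True oct_mult_zero_right)
    qed
  next
    case False
    define m where "m = (1 / (norm u)\<^sup>2) *\<^sub>R (v \<otimes>\<^sub>O oct_cnj u)"
    have m: "m \<otimes>\<^sub>O u = v"
      using False by (simp add: m_def oct_mult_scaleR_left oct_mult_cnj_cancel)
    have uniq: "m' = m" if "v = m' \<otimes>\<^sub>O u" for m'
    proof -
      have "(m' - m) \<otimes>\<^sub>O u = 0" using that m by (simp only: oct_mult_diff_left diff_self)
      then show ?thesis using False by (simp add: oct_mult_eq_0_iff)
    qed
    show ?thesis
      unfolding x
    proof (rule ex1I[of _ "oct_line m"])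
      show "oct_line m \<in> oct_lines \<and> (u, v) \<in> oct_line m"
        by (simp add: oct_lines_def mem_oct_line_iff m)
      show "L = oct_line m" if "L \<in> oct_lines \<and> (u, v) \<in> L" for L
        using that False uniq unfolding oct_lines_def
        by (metis imageE insertE mem_oct_line_iff mem_oct_line_inf_iff)
    qed
  qed
qed

lemma line_through:
  assumes "x \<noteq> 0"
  shows "line_through x \<in> oct_lines" and "x \<in> line_through x"
  using theI'[OF oct_line_through_unique[OF assms]] by (auto simp: line_through_def)

lemma orth_proj_unique:
  fixes V :: "'a::euclidean_space set"
  assumes "subspace V"
  shows "\<exists>!y. y \<in> V \<and> (\<forall>v\<in>V. orthogonal (x - y) v)"
proof -
  obtain y z where "y \<in> span V" "\<And>w. w \<in> span V \<Longrightarrow> orthogonal z w" "x = y + z"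
    using orthogonal_subspace_decomp_exists[of V x] by blast
  then have y: "y \<in> V" "\<forall>v\<in>V. orthogonal (x - y) v"
    using assms by (simp_all add: span_eq_iff[THEN iffD2])
  have "y' = y" if "y' \<in> V" "\<forall>v\<in>V. orthogonal (x - y') v" for y'
  proof -
    have "y' - y \<in> V" using that y assms by (simp add: subspace_diff)
    then have "inner (x - y) (y' - y) = 0" "inner (x - y') (y' - y) = 0"
      using y that by (auto simp: orthogonal_def)
    then have "inner (y' - y) (y' - y) = 0" by (simp add: inner_diff_left)
    then show ?thesis by simp
  qed
  with y show ?thesis by blast
qed

end

theory Submission
  imports Defs
begin

text \<open>
  Write \<open>S\<^sub>x\<close> for the rank-one operator \<open>y \<mapsto> \<langle>x,y\<rangle> x\<close>. The idea is that
  \<open>|x|\<^sup>2 Proj\<^bsub>L(x)\<^esub>\<close> is eight times the Hilbert--Schmidt projection of \<open>S\<^sub>x\<close> onto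
  a fixed ten-dimensional space of symmetric operators on \<open>\<real>\<^sup>1\<^sup>6\<close>, so that the claim is an instance of the
  Cauchy--Schwarz inequality.

  The ten-dimensional space is spanned by the identity and the nine Clifford operators whose
  quadratic forms are the components of the Hopf map
  \<open>(a, b) \<mapsto> (|a|\<^sup>2 - |b|\<^sup>2, 2 b a*)\<close> from \<open>\<real>\<^sup>1\<^sup>6\<close> to \<open>\<real>\<^sup>9\<close>. Adding the form
  \<open>|a|\<^sup>2 + |b|\<^sup>2\<close> of the identity gives a quadratic map \<open>h\<close> into \<open>\<real>\<^sup>1\<^sup>0\<close>, and a
  computation with octonions shows
  \<open>2 |x|\<^sup>2 |Proj\<^bsub>L(x)\<^esub> y|\<^sup>2 = \<langle>h(x), h(y)\<rangle>\<close> (\<open>norm_orth_proj_line_through\<close>). The first double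
  sum is therefore \<open>|H|\<^sup>2 / 2\<close> with \<open>H = h(x\<^sub>1) + \<dots> + h(x\<^sub>n)\<close>.

  On the other side, a point \<open>p\<close> of \<open>\<real>\<^sup>1\<^sup>0\<close> defines a symmetric operator
  \<open>A\<^sub>p\<close> with \<open>\<langle>A\<^sub>p x, x\<rangle> = \<langle>p, h(x)\<rangle>\<close> and squared Hilbert--Schmidt norm \<open>16 |p|\<^sup>2\<close>.
  The Hilbert--Schmidt pairing of \<open>A\<^sub>H\<close> with the frame operator \<open>T = S\<^bsub>x\<^sub>1\<^esub> + \<dots> + S\<^bsub>x\<^sub>n\<^esub>\<close> is
  \<open>|H|\<^sup>2\<close>, while \<open>T\<close> has squared norm \<open>\<Sum>\<^sub>i\<^sub>j \<langle>x\<^sub>i, x\<^sub>j\<rangle>\<^sup>2\<close>. Hence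
  \<open>|H|\<^sup>4 \<le> 16 |H|\<^sup>2 \<Sum>\<^sub>i\<^sub>j \<langle>x\<^sub>i, x\<^sub>j\<rangle>\<^sup>2\<close>, which is the claim.
\<close>

section \<open>The frame operator and the Cauchy--Schwarz inequality\<close>

text \<open>
  This is the Cauchy--Schwarz inequality for the Hilbert--Schmidt inner product of \<open>A\<close> with the
  frame operator \<open>b \<mapsto> \<Sum>\<^sub>i \<langle>x\<^sub>i, b\<rangle> x\<^sub>i\<close>: their pairing is the sum on the left, and the second
  factor on the right is the squared norm of the frame operator.
\<close>

lemma frame_Cauchy_Schwarz:
  fixes A :: "'a::euclidean_space \<Rightarrow> 'a" and x :: "'i \<Rightarrow> 'a"
  assumes "linear A"
  shows "(\<Sum>i\<in>I. inner (A (x i)) (x i))\<^sup>2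
    \<le> (\<Sum>b\<in>Basis. (norm (A b))\<^sup>2) * (\<Sum>i\<in>I. \<Sum>j\<in>I. (inner (x i) (x j))\<^sup>2)"
proof -
  define T where "T b = (\<Sum>i\<in>I. inner (x i) b *\<^sub>R x i)" for b
  have "inner (A (x i)) (x i) = (\<Sum>b\<in>Basis. inner (x i) b * inner (A b) (x i))" for i
  proof -
    have "A (x i) = A (\<Sum>b\<in>Basis. inner (x i) b *\<^sub>R b)"
      by (simp add: euclidean_representation)
    also have "\<dots> = (\<Sum>b\<in>Basis. inner (x i) b *\<^sub>R A b)"
      by (simp add: linear_sum[OF assms] linear_cmul[OF assms])
    finally show ?thesis
      by (simp add: inner_sum_left)
  qed
  then have pairing: "(\<Sum>i\<in>I. inner (A (x i)) (x i)) = (\<Sum>b\<in>Basis. inner (A b) (T b))"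
    by (simp add: T_def inner_sum_right sum.swap[of _ Basis I])
  have "(\<Sum>b\<in>Basis. (norm (T b))\<^sup>2)
    = (\<Sum>b\<in>Basis. \<Sum>i\<in>I. \<Sum>j\<in>I. inner (x i) (x j) * (inner (x i) b * inner (x j) b))"
    by (simp add: T_def power2_norm_eq_inner inner_sum_left inner_sum_right sum_distrib_left
        inner_commute mult_ac)
  also have "\<dots> = (\<Sum>i\<in>I. \<Sum>j\<in>I. inner (x i) (x j) * (\<Sum>b\<in>Basis. inner (x i) b * inner (x j) b))"
    by (simp add: sum_distrib_left sum.swap[of _ Basis I])
  also have "\<dots> = (\<Sum>i\<in>I. \<Sum>j\<in>I. (inner (x i) (x j))\<^sup>2)"
    by (simp add: euclidean_inner[symmetric] power2_eq_square)
  finally have norm_T: "(\<Sum>b\<in>Basis. (norm (T b))\<^sup>2) = (\<Sum>i\<in>I. \<Sum>j\<in>I. (inner (x i) (x j))\<^sup>2)" .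
  have "\<bar>\<Sum>b\<in>Basis. inner (A b) (T b)\<bar> \<le> (\<Sum>b\<in>Basis. norm (A b) * norm (T b))"
    by (rule order_trans[OF sum_abs]) (intro sum_mono Cauchy_Schwarz_ineq2)
  then have "(\<Sum>b\<in>Basis. inner (A b) (T b))\<^sup>2 \<le> (\<Sum>b\<in>Basis. norm (A b) * norm (T b))\<^sup>2"
    by (metis abs_ge_zero power2_abs power_mono)
  also have "\<dots> \<le> (\<Sum>b\<in>Basis. (norm (A b))\<^sup>2) * (\<Sum>b\<in>Basis. (norm (T b))\<^sup>2)"
    by (rule Cauchy_Schwarz_ineq_sum)
  finally show ?thesis
    by (simp only: pairing norm_T)
qed

section \<open>Adjoints and norms of octonionic multiplications\<close>

lemma norm_oct_cnj: "norm (oct_cnj a) = norm a"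
  by (simp add: oct_cnj_def quat_cnj_def norm_prod_def)

lemma inner_oct_mult_eq_inner_right: "inner (a \<otimes>\<^sub>O b) c = inner b (oct_cnj a \<otimes>\<^sub>O c)"
  by (cases a; cases b; cases c)
     (auto simp: oct_defs inner_prod_def inner_complex_def algebra_simps)

lemma inner_oct_mult_eq_inner_left: "inner (a \<otimes>\<^sub>O b) c = inner a (c \<otimes>\<^sub>O oct_cnj b)"
  by (cases a; cases b; cases c)
     (auto simp: oct_defs inner_prod_def inner_complex_def algebra_simps)

section \<open>Projections onto octonionic lines and the Hopf map\<close>

lemma orth_proj_eqI:
  fixes V :: "'a::euclidean_space set"
  assumes "subspace V" "y \<in> V" "\<And>v. v \<in> V \<Longrightarrow> orthogonal (x - y) v"
  shows "orth_proj V x = y"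
  unfolding orth_proj_def using orth_proj_unique[OF assms(1), of x] assms(2,3)
  by (intro the1_equality) auto

lemma line_through_eqI:
  assumes "x \<noteq> 0" "L \<in> oct_lines" "x \<in> L"
  shows "line_through x = L"
  using oct_line_through_unique[OF assms(1)] line_through[OF assms(1)] assms(2,3) by blast

text \<open>
  The map \<open>u \<mapsto> (u, m u)\<close> onto the line multiplies inner products by \<open>1 + |m|\<^sup>2\<close>, and its
  adjoint is \<open>(c, d) \<mapsto> c + m* d\<close>. Hence the projection of \<open>(c, d)\<close> is \<open>(w, m w)\<close> with
  \<open>w = (c + m* d) / (1 + |m|\<^sup>2)\<close>.
\<close>

lemma norm_orth_proj_oct_line:
  "(1 + (norm m)\<^sup>2) * (norm (orth_proj (oct_line m) (c, d)))\<^sup>2 = (norm (c + oct_cnj m \<otimes>\<^sub>O d))\<^sup>2"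
proof -
  define k where "k = 1 + (norm m)\<^sup>2"
  have k: "k > 0" by (simp add: k_def add_pos_nonneg)
  define w where "w = (1 / k) *\<^sub>R (c + oct_cnj m \<otimes>\<^sub>O d)"
  \<comment> \<open>Multiplicativity of the norm, polarized.\<close>
  have inner_mult: "inner (m \<otimes>\<^sub>O u) (m \<otimes>\<^sub>O v) = (norm m)\<^sup>2 * inner u v" for u v
  proof -
    have "(norm (m \<otimes>\<^sub>O (u + v)))\<^sup>2 = (norm m)\<^sup>2 * (norm (u + v))\<^sup>2"
      by (simp add: oct_norm_mult power_mult_distrib)
    moreover have "(norm (m \<otimes>\<^sub>O u))\<^sup>2 = (norm m)\<^sup>2 * (norm u)\<^sup>2"
      "(norm (m \<otimes>\<^sub>O v))\<^sup>2 = (norm m)\<^sup>2 * (norm v)\<^sup>2"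
      by (simp_all add: oct_norm_mult power_mult_distrib)
    ultimately show ?thesis
      by (simp add: oct_mult_add_right power2_norm_eq_inner inner_add_left inner_add_right
          inner_commute algebra_simps)
  qed
  have "orth_proj (oct_line m) (c, d) = (w, m \<otimes>\<^sub>O w)"
  proof (rule orth_proj_eqI)
    show "subspace (oct_line m)"
      by (rule subspace_oct_lines) (simp add: oct_lines_def)
    show "(w, m \<otimes>\<^sub>O w) \<in> oct_line m"
      by (simp add: mem_oct_line_iff)
    fix v assume "v \<in> oct_line m"
    then obtain u where v: "v = (u, m \<otimes>\<^sub>O u)"
      by (auto simp: oct_line_def)
    have "inner ((c, d) - (w, m \<otimes>\<^sub>O w)) v
      = inner c u + inner d (m \<otimes>\<^sub>O u) - k * inner w u"
      by (simp add: v inner_diff_left inner_mult k_def algebra_simps)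
    also have "\<dots> = inner (c + oct_cnj m \<otimes>\<^sub>O d) u - k * inner w u"
      using inner_oct_mult_eq_inner_right[of m u d]
      by (simp add: inner_add_left inner_add_right inner_commute)
    also have "\<dots> = 0"
      using k by (simp add: w_def)
    finally show "orthogonal ((c, d) - (w, m \<otimes>\<^sub>O w)) v"
      by (simp add: orthogonal_def)
  qed
  then have "(norm (orth_proj (oct_line m) (c, d)))\<^sup>2 = k * (norm w)\<^sup>2"
    by (simp add: norm_Pair oct_norm_mult power_mult_distrib k_def algebra_simps)
  then have "k * (norm (orth_proj (oct_line m) (c, d)))\<^sup>2 = (norm (k *\<^sub>R w))\<^sup>2"
    by (simp add: power_mult_distrib power2_eq_square)
  also have "k *\<^sub>R w = c + oct_cnj m \<otimes>\<^sub>O d"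
    using k by (simp add: w_def)
  finally show ?thesis
    by (simp only: k_def)
qed

lemma orth_proj_oct_line_inf: "orth_proj oct_line_inf (c, d) = (0, d)"
proof (rule orth_proj_eqI)
  show "subspace oct_line_inf"
    by (rule subspace_oct_lines) (simp add: oct_lines_def)
qed (auto simp: oct_line_inf_def orthogonal_def)

text \<open>
  The last two components are the Hopf map from \<open>\<real>\<^sup>1\<^sup>6\<close> to \<open>\<real>\<^sup>9\<close>; on the unit
  sphere its fibres are the unit spheres of the octonionic lines. The squared norm is prepended so
  that the formula for projections below becomes a single inner product.
\<close>

definition hopf :: "oct \<times> oct \<Rightarrow> real \<times> real \<times> oct" where
  "hopf x = ((norm (fst x))\<^sup>2 + (norm (snd x))\<^sup>2, (norm (fst x))\<^sup>2 - (norm (snd x))\<^sup>2,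
     2 *\<^sub>R (snd x \<otimes>\<^sub>O oct_cnj (fst x)))"

text \<open>
  With \<open>x = (a, b)\<close> and \<open>y = (c, d)\<close>, both sides are twice
  \<open>|a|\<^sup>2 |c|\<^sup>2 + |b|\<^sup>2 |d|\<^sup>2 + 2 \<langle>b a*, d c*\<rangle>\<close>. For \<open>a \<noteq> 0\<close> the line has slope
  \<open>m = b a* / |a|\<^sup>2\<close>; then \<open>|x|\<^sup>2 = |a|\<^sup>2 (1 + |m|\<^sup>2)\<close> cancels the denominator of
  the projection and leaves \<open>|a|\<^sup>2 |c + m* d|\<^sup>2\<close>, whose cross term is moved to
  \<open>\<langle>b a*, d c*\<rangle>\<close> by the two adjunction rules.
\<close>

lemma norm_orth_proj_line_through:
  assumes "x \<noteq> 0"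
  shows "2 * ((norm x)\<^sup>2 * (norm (orth_proj (line_through x) y))\<^sup>2) = inner (hopf x) (hopf y)"
proof -
  obtain a b c d where xy: "x = (a, b)" "y = (c, d)"
    by (cases x; cases y)
  have "(norm x)\<^sup>2 * (norm (orth_proj (line_through x) y))\<^sup>2
    = (norm a)\<^sup>2 * (norm c)\<^sup>2 + (norm b)\<^sup>2 * (norm d)\<^sup>2
      + 2 * inner (b \<otimes>\<^sub>O oct_cnj a) (d \<otimes>\<^sub>O oct_cnj c)"
  proof (cases "a = 0")
    case True
    have "line_through x = oct_line_inf"
      using assms True by (intro line_through_eqI) (auto simp: xy oct_lines_def mem_oct_line_inf_iff)
    then show ?thesis
      by (simp add: xy True orth_proj_oct_line_inf norm_Pair inner_oct_mult_eq_inner_left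
          oct_defs zero_prod_def[symmetric])
  next
    case False
    define m where "m = (1 / (norm a)\<^sup>2) *\<^sub>R (b \<otimes>\<^sub>O oct_cnj a)"
    have ma: "m \<otimes>\<^sub>O a = b"
      using False by (simp add: m_def oct_mult_scaleR_left oct_mult_cnj_cancel)
    have line: "line_through x = oct_line m"
      using assms by (intro line_through_eqI) (auto simp: xy oct_lines_def mem_oct_line_iff ma)
    have norm_b: "(norm b)\<^sup>2 = (norm a)\<^sup>2 * (norm m)\<^sup>2"
      by (simp add: ma[symmetric] oct_norm_mult power_mult_distrib)
    have "inner c (oct_cnj m \<otimes>\<^sub>O d) = inner m (d \<otimes>\<^sub>O oct_cnj c)"
      by (metis inner_oct_mult_eq_inner_left inner_oct_mult_eq_inner_right)
    then have cross: "(norm a)\<^sup>2 * inner c (oct_cnj m \<otimes>\<^sub>O d)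
      = inner (b \<otimes>\<^sub>O oct_cnj a) (d \<otimes>\<^sub>O oct_cnj c)"
      using False by (simp add: m_def)
    have "(norm x)\<^sup>2 * (norm (orth_proj (line_through x) y))\<^sup>2
      = (norm a)\<^sup>2 * ((1 + (norm m)\<^sup>2) * (norm (orth_proj (oct_line m) (c, d)))\<^sup>2)"
      by (simp add: line[unfolded xy] xy norm_Pair norm_b algebra_simps)
    also have "\<dots> = (norm a)\<^sup>2 * (norm (c + oct_cnj m \<otimes>\<^sub>O d))\<^sup>2"
      by (simp only: norm_orth_proj_oct_line)
    also have "(norm (c + oct_cnj m \<otimes>\<^sub>O d))\<^sup>2
      = (norm c)\<^sup>2 + (norm m)\<^sup>2 * (norm d)\<^sup>2 + 2 * inner c (oct_cnj m \<otimes>\<^sub>O d)"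
      using dot_norm[of c "oct_cnj m \<otimes>\<^sub>O d"]
      by (simp add: oct_norm_mult norm_oct_cnj power_mult_distrib field_simps)
    finally show ?thesis
      by (simp add: cross[symmetric] norm_b algebra_simps)
  qed
  then show ?thesis
    by (simp add: hopf_def xy algebra_simps)
qed

section \<open>The ten-dimensional space of Clifford operators\<close>

text \<open>
  As a block matrix this is \<open>((s + r, L\<^bsub>w*\<^esub>), (L\<^sub>w, s - r))\<close>, where \<open>L\<^sub>w\<close> is left
  multiplication by \<open>w\<close>: the symmetric operator that has the linear combination
  \<open>\<langle>p, h(x)\<rangle>\<close> of the components of \<open>h = hopf\<close> as its quadratic form.
\<close>

definition clifford_op :: "real \<times> real \<times> oct \<Rightarrow> oct \<times> oct \<Rightarrow> oct \<times> oct" where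
  "clifford_op p x = (case p of (s, r, w) \<Rightarrow>
     ((s + r) *\<^sub>R fst x + oct_cnj w \<otimes>\<^sub>O snd x, w \<otimes>\<^sub>O fst x + (s - r) *\<^sub>R snd x))"

lemma linear_clifford_op: "linear (clifford_op p)"
  by (rule linearI)
     (auto simp: clifford_op_def split_beta prod_eq_iff oct_mult_add_right oct_mult_scaleR_right
        scaleR_add_right mult.commute)

lemma inner_clifford_op_eq_inner_hopf: "inner (clifford_op p x) x = inner p (hopf x)"
proof -
  obtain s r w a b where px: "p = (s, r, w)" "x = (a, b)"
    by (cases p; cases x) auto
  have "inner (oct_cnj w \<otimes>\<^sub>O b) a = inner (w \<otimes>\<^sub>O a) b"
    by (metis inner_commute inner_oct_mult_eq_inner_right)
  then show ?thesis
    by (simp add: px clifford_op_def hopf_def inner_add_left inner_oct_mult_eq_inner_left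
        power2_norm_eq_inner algebra_simps)
qed

lemma sum_Basis_prod:
  fixes f :: "'a::euclidean_space \<times> 'b::euclidean_space \<Rightarrow> 'c::comm_monoid_add"
  shows "sum f Basis = (\<Sum>b\<in>Basis. f (b, 0)) + (\<Sum>b\<in>Basis. f (0, b))"
  unfolding Basis_prod_def
  by (subst sum.union_disjoint) (auto simp: sum.reindex inj_on_def)

text \<open>
  Each of the sixteen basis vectors lies in one of the two summands. For \<open>p = (s, r, w)\<close>
  the operator acts on it by a scalar into the same summand and by multiplication with \<open>w\<close> or \<open>w*\<close>, a similarity of ratio \<open>|w|\<close>, into
  the other one.
\<close>

lemma hilbert_schmidt_norm_clifford_op:
  "(\<Sum>b\<in>Basis. (norm (clifford_op p b))\<^sup>2) = 16 * (norm p)\<^sup>2"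
proof -
  obtain s r w where p: "p = (s, r, w)"
    by (cases p) auto
  have "(norm (clifford_op p (e, 0)))\<^sup>2 = (s + r)\<^sup>2 + (norm w)\<^sup>2"
    "(norm (clifford_op p (0, e)))\<^sup>2 = (norm w)\<^sup>2 + (s - r)\<^sup>2" if "e \<in> Basis" for e :: oct
    using that
    by (simp_all add: p clifford_op_def norm_Pair oct_norm_mult norm_oct_cnj)
  then have "(\<Sum>b\<in>Basis. (norm (clifford_op p b))\<^sup>2)
    = DIM(oct) * ((s + r)\<^sup>2 + (norm w)\<^sup>2) + DIM(oct) * ((norm w)\<^sup>2 + (s - r)\<^sup>2)"
    by (simp add: sum_Basis_prod)
  then show ?thesis
    by (simp add: p norm_Pair power2_eq_square algebra_simps)
qed

section \<open>The inequality\<close>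

theorem proposition3p10:
  fixes n :: nat and x :: "nat \<Rightarrow> oct \<times> oct"
  assumes "\<And>i. i \<in> {1..n} \<Longrightarrow> x i \<noteq> 0"
  shows "(\<Sum>j = 1..n. \<Sum>i = 1..n.
            (norm (x j))\<^sup>2 * (norm (orth_proj (line_through (x j)) (x i)))\<^sup>2)
         - 8 * (\<Sum>j = 1..n. \<Sum>i = 1..n. (inner (x i) (x j))\<^sup>2) \<le> 0"
proof -
  define H where "H = (\<Sum>i = 1..n. hopf (x i))"
  define F where "F = (\<Sum>j = 1..n. \<Sum>i = 1..n. (inner (x i) (x j))\<^sup>2)"
  have "2 * (\<Sum>j = 1..n. \<Sum>i = 1..n.
      (norm (x j))\<^sup>2 * (norm (orth_proj (line_through (x j)) (x i)))\<^sup>2)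
    = (\<Sum>j = 1..n. \<Sum>i = 1..n. inner (hopf (x j)) (hopf (x i)))"
    unfolding sum_distrib_left
    by (intro sum.cong refl norm_orth_proj_line_through assms)
  also have "\<dots> = (norm H)\<^sup>2"
    by (simp add: H_def power2_norm_eq_inner inner_sum_left inner_sum_right) (rule sum.swap)
  finally have lhs: "2 * (\<Sum>j = 1..n. \<Sum>i = 1..n.
      (norm (x j))\<^sup>2 * (norm (orth_proj (line_through (x j)) (x i)))\<^sup>2) = (norm H)\<^sup>2" .
  have "(\<Sum>i = 1..n. inner (clifford_op H (x i)) (x i)) = (norm H)\<^sup>2"
    by (simp add: inner_clifford_op_eq_inner_hopf H_def power2_norm_eq_inner inner_sum_right)
  then have "((norm H)\<^sup>2)\<^sup>2 \<le> 16 * (norm H)\<^sup>2 * F"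
    using frame_Cauchy_Schwarz[OF linear_clifford_op, of H x "{1..n}"]
    by (simp add: hilbert_schmidt_norm_clifford_op F_def inner_commute)
  moreover have "F \<ge> 0"
    by (simp add: F_def sum_nonneg)
  ultimately have "(norm H)\<^sup>2 \<le> 16 * F"
    by (cases "H = 0") (simp_all add: power2_eq_square)
  with lhs show ?thesis
    by (simp add: F_def)
qed

end
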